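(* Let $\{E_J,\pi^K_J\}_{J,K\in A}$ be a perfect inverse system with projective limit $E_A$, let $\{L_J,\hat E_J^0\}_{J\in A}$ be a projective system of functionals on it, and let $(L_{min},D(L_{min}))$ be its minimal extension. Then the domain of the minimal extension is given by the direct limit of the direct system $\{\hat E_J^0,\mathcal{E}_J^K\}_{J,K\in A}$: $$D(L_{min})=\varinjlim \hat E_J^0,$$ where the identification is via the correspondence $\varinjlim\hat E_J^0\to D(L_{min})$, $[f_J]\mapsto \mathcal{E}_J^A f_J$ (for $J\in A$, $f_J\in\hat E_J^0$), which is a well-defined bijection.
   Context: Projective families. A directed set $A$ is a partially ordered set $(A,\le)$ such that for all $J,K\in A$ there is $R\in A$ with $J\le R$, $K\le R$. A projective (inverse) family of sets $\{E_J,\pi^K_J\}_{J,K\in A}$ consists of non-empty sets $E_J$ indexed by a non-empty directed set $A$ and, for every $J\le K$, a surjective map $\pi^K_J:E_K\to E_J$, such that $\pi^K_K=\mathrm{id}_{E_K}$ and $\pi^R_J=\pi^K_J\circ\pi^R_K$ for $J\le K\le R$. Its projective limit is $$E_A:=\{(x_J)_{J\in A}\in\prod_{J\in A}E_J : x_J=\pi^K_J(x_K)\ \text{for all } J\le K\},$$ and $\pi_J:E_A\to E_J$ denotes the restriction to $E_A$ of the coordinate projection. The family is called a perfect inverse system if for every $J\in A$ and $x_J\in E_J$ there is $x\in E_A$ with $\pi_J x=x_J$. Functions and extension maps. $\hat E_J$ (resp. $\hat E_A$) is the space of all functions $E_J\to\mathbb{C}$ (resp. $E_A\to\mathbb{C}$).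 For $J\le K$ the map $\mathcal{E}_J^K:\hat E_J\to\hat E_K$ is $\mathcal{E}_J^K(f_J):=f_J\circ\pi^K_J$, and $\mathcal{E}_J^A:\hat E_J\to\hat E_A$ is $\mathcal{E}_J^A f_J:=f_J\circ\pi_J$. Functionals. A functional is a complex-valued linear map defined on a linear subspace (its domain) of a space of complex-valued functions. A projective system of functionals $\{L_J,\hat E_J^0\}_{J\in A}$ is a family of functionals $L_J:\hat E_J^0\to\mathbb{C}$ with domain $\hat E_J^0\subseteq\hat E_J$ such that for all $J\le K$ and all $f_J\in\hat E_J^0$: $\mathcal{E}_J^K(f_J)\in\hat E_K^0$ and $L_K(\mathcal{E}_J^K(f_J))=L_J(f_J)$. Minimal extension. The minimal extension $(L_{min},D(L_{min}))$ has domain $D(L_{min}):=\mathcal{C}_0:=\bigcup_{J\in A}\mathcal{E}_J^A(\hat E_J^0)\subseteq\hat E_A$ and is given by $L_{min}(\mathcal{E}_J^A f_J):=L_J(f_J)$ for $J\in A$, $f_J\in\hat E_J^0$ (this is well defined for a perfect inverse system). Direct limits. A direct system on $A$ is a family of non-empty sets $\{X_J\}_{J\in A}$ with maps $F_{JK}:X_J\to X_K$ for $J\le K$, such that $F_{JJ}=\mathrm{id}$ and $F_{KR}\circ F_{JK}=F_{JR}$ for $J\le K\le R$. Its direct limit $\varinjlim X_J$ is the disjoint union of the $X_J$ modulo the equivalence relation: $\omega_J\in X_J$ and $\omega_K\in X_K$ are equivalent iff there is $R\in A$ with $J\le R$, $K\le R$ and $F_{JR}(\omega_J)=F_{KR}(\omega_K)$.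 Here $X_J=\hat E_J^0$ and $F_{JK}=\mathcal{E}_J^K$ restricted to $\hat E_J^0$; $[f_J]$ denotes the class of $f_J\in\hat E_J^0$. *)

theory Defs
  imports Complex_Main "HOL-Library.FuncSet"
begin

text \<open>
  The order on the index set \<open>A\<close> is a relation \<open>r\<close> on \<open>A\<close>: \<open>(J, K) \<in> r\<close> stands for \<open>J \<le> K\<close>.
  The sets \<open>E J\<close> are subsets of one common type, and \<open>p J K\<close> stands for the map
  \<open>\<pi>\<^sup>K\<^sub>J : E K \<rightarrow> E J\<close>; its values outside \<open>E K\<close> are irrelevant.
\<close>

locale directed_set =
  fixes A :: "'i set" and r :: "('i \<times> 'i) set"
  assumes partial_order: "partial_order_on A r"
    and directed: "\<And>J K. J \<in> A \<Longrightarrow> K \<in> A \<Longrightarrow> \<exists>R\<in>A. (J, R) \<in> r \<and> (K, R) \<in> r"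
begin

lemma le_carrier: "(J, K) \<in> r \<Longrightarrow> J \<in> A \<and> K \<in> A"
  using partial_order by (auto simp: partial_order_on_def preorder_on_def)

lemma le_refl: "J \<in> A \<Longrightarrow> (J, J) \<in> r"
  using partial_order by (auto simp: partial_order_on_def preorder_on_def refl_on_def)

lemma le_trans: "(J, K) \<in> r \<Longrightarrow> (K, R) \<in> r \<Longrightarrow> (J, R) \<in> r"
  using partial_order unfolding partial_order_on_def preorder_on_def by (blast dest: transD)

end


subsection \<open>Projective families\<close>

locale inverse_family = directed_set A r
  for A :: "'i set" and r :: "('i \<times> 'i) set" +
  fixes E :: "'i \<Rightarrow> 'a set" and p :: "'i \<Rightarrow> 'i \<Rightarrow> 'a \<Rightarrow> 'a"
  assumes index_nonempty: "A \<noteq> {}"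
    and E_nonempty: "\<And>J. J \<in> A \<Longrightarrow> E J \<noteq> {}"
    and p_surj: "\<And>J K. (J, K) \<in> r \<Longrightarrow> p J K ` E K = E J"
    and p_id: "\<And>K x. K \<in> A \<Longrightarrow> x \<in> E K \<Longrightarrow> p K K x = x"
    and p_comp: "\<And>J K R x. (J, K) \<in> r \<Longrightarrow> (K, R) \<in> r \<Longrightarrow> x \<in> E R \<Longrightarrow>
                   p J R x = p J K (p K R x)"

definition proj_limit ::
    "'i set \<Rightarrow> ('i \<times> 'i) set \<Rightarrow> ('i \<Rightarrow> 'a set) \<Rightarrow> ('i \<Rightarrow> 'i \<Rightarrow> 'a \<Rightarrow> 'a) \<Rightarrow> ('i \<Rightarrow> 'a) set" where
  "proj_limit A r E p = {x \<in> Pi\<^sub>E A E. \<forall>J K. (J, K) \<in> r \<longrightarrow> x J = p J K (x K)}"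

definition coord_proj ::
    "'i set \<Rightarrow> ('i \<times> 'i) set \<Rightarrow> ('i \<Rightarrow> 'a set) \<Rightarrow> ('i \<Rightarrow> 'i \<Rightarrow> 'a \<Rightarrow> 'a) \<Rightarrow> 'i \<Rightarrow> ('i \<Rightarrow> 'a) \<Rightarrow> 'a" where
  "coord_proj A r E p J = (\<lambda>x\<in>proj_limit A r E p. x J)"

locale perfect_inverse_system = inverse_family A r E p
  for A :: "'i set" and r :: "('i \<times> 'i) set"
    and E :: "'i \<Rightarrow> 'a set" and p :: "'i \<Rightarrow> 'i \<Rightarrow> 'a \<Rightarrow> 'a" +
  assumes perfect:
    "\<And>J y. J \<in> A \<Longrightarrow> y \<in> E J \<Longrightarrow> \<exists>x\<in>proj_limit A r E p. coord_proj A r E p J x = y"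


subsection \<open>Functions and functionals\<close>

text \<open>
  Complex functions on a set \<open>S\<close> are the extensional functions \<open>S \<rightarrow>\<^sub>E UNIV\<close>, so that two of them
  are equal iff they agree on \<open>S\<close>. Accordingly the vector space operations are pointwise on \<open>S\<close>
  and pullbacks are formed with \<^const>\<open>compose\<close>.
\<close>

definition function_subspace :: "'b set \<Rightarrow> ('b \<Rightarrow> complex) set \<Rightarrow> bool" where
  "function_subspace S V \<longleftrightarrow>
     V \<subseteq> (S \<rightarrow>\<^sub>E UNIV) \<and>
     (\<lambda>x\<in>S. 0) \<in> V \<and>
     (\<forall>f\<in>V. \<forall>g\<in>V. (\<lambda>x\<in>S. f x + g x) \<in> V) \<and>
     (\<forall>c. \<forall>f\<in>V. (\<lambda>x\<in>S. c * f x) \<in> V)"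

definition functional_on :: "'b set \<Rightarrow> ('b \<Rightarrow> complex) set \<Rightarrow> (('b \<Rightarrow> complex) \<Rightarrow> complex) \<Rightarrow> bool" where
  "functional_on S V l \<longleftrightarrow>
     function_subspace S V \<and>
     (\<forall>f\<in>V. \<forall>g\<in>V. l (\<lambda>x\<in>S. f x + g x) = l f + l g) \<and>
     (\<forall>c. \<forall>f\<in>V. l (\<lambda>x\<in>S. c * f x) = c * l f)"

definition ext_map ::
    "('i \<Rightarrow> 'a set) \<Rightarrow> ('i \<Rightarrow> 'i \<Rightarrow> 'a \<Rightarrow> 'a) \<Rightarrow> 'i \<Rightarrow> 'i \<Rightarrow> ('a \<Rightarrow> complex) \<Rightarrow> ('a \<Rightarrow> complex)" where
  "ext_map E p J K f = compose (E K) f (p J K)"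

definition ext_lim ::
    "'i set \<Rightarrow> ('i \<times> 'i) set \<Rightarrow> ('i \<Rightarrow> 'a set) \<Rightarrow> ('i \<Rightarrow> 'i \<Rightarrow> 'a \<Rightarrow> 'a) \<Rightarrow>
     'i \<Rightarrow> ('a \<Rightarrow> complex) \<Rightarrow> (('i \<Rightarrow> 'a) \<Rightarrow> complex)" where
  "ext_lim A r E p J f = compose (proj_limit A r E p) f (coord_proj A r E p J)"

locale projective_functionals = inverse_family A r E p
  for A :: "'i set" and r :: "('i \<times> 'i) set"
    and E :: "'i \<Rightarrow> 'a set" and p :: "'i \<Rightarrow> 'i \<Rightarrow> 'a \<Rightarrow> 'a" +
  fixes L :: "'i \<Rightarrow> ('a \<Rightarrow> complex) \<Rightarrow> complex"
    and E0 :: "'i \<Rightarrow> ('a \<Rightarrow> complex) set"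
  assumes L_functional: "\<And>J. J \<in> A \<Longrightarrow> functional_on (E J) (E0 J) (L J)"
    and ext_in: "\<And>J K f. (J, K) \<in> r \<Longrightarrow> f \<in> E0 J \<Longrightarrow> ext_map E p J K f \<in> E0 K"
    and L_ext: "\<And>J K f. (J, K) \<in> r \<Longrightarrow> f \<in> E0 J \<Longrightarrow> L K (ext_map E p J K f) = L J f"

text \<open>
  The minimal extension as a pair of a functional and its domain. The value at \<open>h\<close> in the domain
  does not depend on the choice of \<open>J\<close> and \<open>f\<close>; see \<open>minimal_extension_eq\<close> below.
\<close>

definition minimal_extension ::
    "'i set \<Rightarrow> ('i \<times> 'i) set \<Rightarrow> ('i \<Rightarrow> 'a set) \<Rightarrow> ('i \<Rightarrow> 'i \<Rightarrow> 'a \<Rightarrow> 'a) \<Rightarrow>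
     ('i \<Rightarrow> ('a \<Rightarrow> complex) \<Rightarrow> complex) \<Rightarrow> ('i \<Rightarrow> ('a \<Rightarrow> complex) set) \<Rightarrow>
     ((('i \<Rightarrow> 'a) \<Rightarrow> complex) \<Rightarrow> complex) \<times> (('i \<Rightarrow> 'a) \<Rightarrow> complex) set" where
  "minimal_extension A r E p L E0 =
     (\<lambda>h. THE c. \<exists>J\<in>A. \<exists>f\<in>E0 J. h = ext_lim A r E p J f \<and> c = L J f,
      \<Union>J\<in>A. ext_lim A r E p J ` E0 J)"


subsection \<open>Direct limits\<close>

locale direct_system = directed_set A r
  for A :: "'i set" and r :: "('i \<times> 'i) set" +
  fixes X :: "'i \<Rightarrow> 'x set" and F :: "'i \<Rightarrow> 'i \<Rightarrow> 'x \<Rightarrow> 'x"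
  assumes X_nonempty: "\<And>J. J \<in> A \<Longrightarrow> X J \<noteq> {}"
    and F_in: "\<And>J K w. (J, K) \<in> r \<Longrightarrow> w \<in> X J \<Longrightarrow> F J K w \<in> X K"
    and F_id: "\<And>J w. J \<in> A \<Longrightarrow> w \<in> X J \<Longrightarrow> F J J w = w"
    and F_comp: "\<And>J K R w. (J, K) \<in> r \<Longrightarrow> (K, R) \<in> r \<Longrightarrow> w \<in> X J \<Longrightarrow>
                   F K R (F J K w) = F J R w"

definition direct_limit_rel ::
    "'i set \<Rightarrow> ('i \<times> 'i) set \<Rightarrow> ('i \<Rightarrow> 'x set) \<Rightarrow> ('i \<Rightarrow> 'i \<Rightarrow> 'x \<Rightarrow> 'x) \<Rightarrow> (('i \<times> 'x) \<times> ('i \<times> 'x)) set" where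
  "direct_limit_rel A r X F =
     {((J, w), (K, v)) | J w K v. (J, w) \<in> Sigma A X \<and> (K, v) \<in> Sigma A X \<and>
        (\<exists>R\<in>A. (J, R) \<in> r \<and> (K, R) \<in> r \<and> F J R w = F K R v)}"

definition direct_limit ::
    "'i set \<Rightarrow> ('i \<times> 'i) set \<Rightarrow> ('i \<Rightarrow> 'x set) \<Rightarrow> ('i \<Rightarrow> 'i \<Rightarrow> 'x \<Rightarrow> 'x) \<Rightarrow> ('i \<times> 'x) set set" where
  "direct_limit A r X F = Sigma A X // direct_limit_rel A r X F"

definition limit_class ::
    "'i set \<Rightarrow> ('i \<times> 'i) set \<Rightarrow> ('i \<Rightarrow> 'x set) \<Rightarrow> ('i \<Rightarrow> 'i \<Rightarrow> 'x \<Rightarrow> 'x) \<Rightarrow> 'i \<Rightarrow> 'x \<Rightarrow> ('i \<times> 'x) set" where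
  "limit_class A r X F J w = direct_limit_rel A r X F `` {(J, w)}"

lemma (in direct_system) equiv_direct_limit_rel:
  "equiv (Sigma A X) (direct_limit_rel A r X F)"
proof (rule equivI)
  show "direct_limit_rel A r X F \<subseteq> Sigma A X \<times> Sigma A X"
    by (auto simp: direct_limit_rel_def)
  show "refl_on (Sigma A X) (direct_limit_rel A r X F)"
    using le_refl by (auto simp: refl_on_def direct_limit_rel_def)
  show "sym (direct_limit_rel A r X F)"
    by (rule symI) (auto simp: direct_limit_rel_def, metis)
  show "trans (direct_limit_rel A r X F)"
  proof (rule transI)
    fix x y z
    assume "(x, y) \<in> direct_limit_rel A r X F" and "(y, z) \<in> direct_limit_rel A r X F"
    then obtain J w K v M u R S where
      xyz: "x = (J, w)" "y = (K, v)" "z = (M, u)"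
      and J: "J \<in> A" "w \<in> X J" and K: "K \<in> A" "v \<in> X K" and M: "M \<in> A" "u \<in> X M"
      and R: "R \<in> A" "(J, R) \<in> r" "(K, R) \<in> r" "F J R w = F K R v"
      and S: "S \<in> A" "(K, S) \<in> r" "(M, S) \<in> r" "F K S v = F M S u"
      by (auto simp: direct_limit_rel_def)
    obtain T where T: "T \<in> A" "(R, T) \<in> r" "(S, T) \<in> r"
      using directed R(1) S(1) by blast
    have "F J T w = F R T (F J R w)" using F_comp[OF R(2) T(2) J(2)] by simp
    also have "\<dots> = F K T v" using F_comp[OF R(3) T(2) K(2)] R(4) by simp
    also have "\<dots> = F S T (F K S v)" using F_comp[OF S(2) T(3) K(2)] by simp
    also have "\<dots> = F M T u" using F_comp[OF S(3) T(3) M(2)] S(4) by simp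
    finally show "(x, z) \<in> direct_limit_rel A r X F"
      using xyz J M T le_trans R(2) S(3) unfolding direct_limit_rel_def by blast
  qed
qed


subsection \<open>Consistency of the definitions\<close>

context inverse_family
begin

lemma p_in: "(J, K) \<in> r \<Longrightarrow> x \<in> E K \<Longrightarrow> p J K x \<in> E J"
  using p_surj by blast

lemma ext_lim_ext_map:
  assumes "(J, K) \<in> r"
  shows "ext_lim A r E p K (ext_map E p J K f) = ext_lim A r E p J f"
proof
  fix x
  show "ext_lim A r E p K (ext_map E p J K f) x = ext_lim A r E p J f x"
    using assms le_carrier[OF assms]
    by (auto simp: ext_lim_def ext_map_def compose_def coord_proj_def proj_limit_def PiE_mem)
qed

end

lemma (in projective_functionals) direct_system_ext_map: "direct_system A r E0 (ext_map E p)"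
proof
  fix J assume "J \<in> A"
  then show "E0 J \<noteq> {}"
    using L_functional unfolding functional_on_def function_subspace_def by blast
next
  fix J K f assume "(J, K) \<in> r" "f \<in> E0 J"
  then show "ext_map E p J K f \<in> E0 K" by (rule ext_in)
next
  fix J f assume *: "J \<in> A" "f \<in> E0 J"
  then have "f \<in> E J \<rightarrow>\<^sub>E UNIV"
    using L_functional unfolding functional_on_def function_subspace_def by blast
  then show "ext_map E p J J f = f"
    using p_id * by (auto simp: ext_map_def compose_def fun_eq_iff PiE_def extensional_def)
next
  fix J K R f assume "(J, K) \<in> r" "(K, R) \<in> r"
  then show "ext_map E p K R (ext_map E p J K f) = ext_map E p J R f"
    using p_comp p_in by (auto simp: ext_map_def compose_def fun_eq_iff)
qed

lemma minimal_extension_eq: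
  assumes "perfect_inverse_system A r E p" and "projective_functionals A r E p L E0"
    and J: "J \<in> A" "f \<in> E0 J"
  shows "fst (minimal_extension A r E p L E0) (ext_lim A r E p J f) = L J f"
proof -
  interpret perfect_inverse_system A r E p by fact
  interpret projective_functionals A r E p L E0 by fact
  have "L K g = L J f"
    if K: "K \<in> A" "g \<in> E0 K" and eq: "ext_lim A r E p J f = ext_lim A r E p K g" for K g
  proof -
    obtain R where R: "R \<in> A" "(J, R) \<in> r" "(K, R) \<in> r"
      using directed J(1) K(1) by blast
    let ?f = "ext_map E p J R f" and ?g = "ext_map E p K R g"
    have "?f y = ?g y" for y
    proof (cases "y \<in> E R")
      case True
      then obtain x where x: "x \<in> proj_limit A r E p" "coord_proj A r E p R x = y"
        using perfect R(1) by blast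
      have "ext_lim A r E p R ?f x = ext_lim A r E p R ?g x"
        using ext_lim_ext_map R eq by simp
      then show ?thesis using x by (simp add: ext_lim_def compose_def)
    qed (simp add: ext_map_def compose_def)
    then have "?f = ?g" ..
    then show ?thesis using L_ext R J K by metis
  qed
  then show ?thesis
    unfolding minimal_extension_def fst_conv using J by (intro the_equality) blast+
qed

end

theory Submission
  imports Defs
begin

text \<open>
  In a perfect inverse system pulling back along \<open>\<pi>\<^sub>R\<close> is injective, because \<open>\<pi>\<^sub>R\<close> is onto \<open>E R\<close>.
  Hence two functions on \<open>E J\<close> and \<open>E K\<close> have the same extension to the projective limit iff their
  extensions to \<open>E R\<close> agree for an upper bound \<open>R\<close> of \<open>J\<close> and \<open>K\<close>. So the direct limit relation is
  the kernel of \<open>(J, f) \<mapsto> \<E>\<^sub>J\<^sup>A f\<close>, and the direct limit is in bijection with the image of that map.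
\<close>

lemma bij_betw_quotient_kernel:
  assumes R: "equiv S R"
    and kernel: "\<And>x y. x \<in> S \<Longrightarrow> y \<in> S \<Longrightarrow> (x, y) \<in> R \<longleftrightarrow> g x = g y"
  obtains h where "\<And>x. x \<in> S \<Longrightarrow> h (R `` {x}) = g x" and "bij_betw h (S // R) (g ` S)"
proof
  \<comment> \<open>By \<open>kernel\<close>, \<open>g\<close> is constant on each class, so its
    image of a class is a singleton and \<open>the_elem\<close> reads off the value without choosing
    a representative.\<close>
  let ?h = "\<lambda>C. the_elem (g ` C)"
  show h: "?h (R `` {x}) = g x" if x: "x \<in> S" for x
  proof -
    have "g ` (R `` {x}) = {g x}"
      using equiv_class_self[OF R x] kernel[OF x] equiv_type[OF R] by fastforce
    then show ?thesis by simp
  qed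
  have "inj_on ?h (S // R)"
  proof (rule inj_onI)
    fix C D assume "C \<in> S // R" "D \<in> S // R" and eq: "?h C = ?h D"
    then obtain x y where xy: "x \<in> S" "C = R `` {x}" "y \<in> S" "D = R `` {y}"
      by (elim quotientE)
    then have "(x, y) \<in> R" using eq h kernel by simp
    then show "C = D" using equiv_class_eq[OF R] xy by simp
  qed
  moreover have "?h ` (S // R) = g ` S"
    unfolding quotient_def by (auto simp: h image_UN)
  ultimately show "bij_betw ?h (S // R) (g ` S)"
    by (simp add: bij_betw_def)
qed

context perfect_inverse_system
begin

lemma ext_lim_inject:
  assumes J: "J \<in> A" and "f \<in> extensional (E J)" "g \<in> extensional (E J)"
    and eq: "ext_lim A r E p J f = ext_lim A r E p J g"
  shows "f = g"
proof (rule extensionalityI)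
  fix y assume "y \<in> E J"
  then obtain x where "x \<in> proj_limit A r E p" "coord_proj A r E p J x = y"
    using perfect[OF J] by blast
  then show "f y = g y"
    using fun_cong[OF eq, of x] by (simp add: ext_lim_def compose_def)
qed (use assms in auto)

text \<open>Both extensions to the limit factor through \<open>E R\<close>, so their equality
  descends to \<open>E R\<close> by injectivity; \<open>ext_map\<close> yields extensional
  functions, as \<open>ext_lim_inject\<close> requires.\<close>

lemma ext_lim_eq_iff:
  assumes J: "(J, R) \<in> r" and K: "(K, R) \<in> r"
  shows "ext_lim A r E p J f = ext_lim A r E p K g \<longleftrightarrow> ext_map E p J R f = ext_map E p K R g"
proof
  assume "ext_lim A r E p J f = ext_lim A r E p K g"
  then have "ext_lim A r E p R (ext_map E p J R f) = ext_lim A r E p R (ext_map E p K R g)"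
    by (simp add: ext_lim_ext_map J K)
  then show "ext_map E p J R f = ext_map E p K R g"
    using le_carrier[OF J] by (auto intro: ext_lim_inject simp: ext_map_def)
next
  assume "ext_map E p J R f = ext_map E p K R g"
  then show "ext_lim A r E p J f = ext_lim A r E p K g"
    using ext_lim_ext_map J K by metis
qed

text \<open>By \<open>ext_lim_eq_iff\<close>, agreement at one upper bound already forces equality
  on the limit; conversely, directedness supplies an upper bound at which to compare.\<close>

lemma direct_limit_rel_iff:
  assumes "J \<in> A" "f \<in> X J" "K \<in> A" "g \<in> X K"
  shows "((J, f), (K, g)) \<in> direct_limit_rel A r X (ext_map E p) \<longleftrightarrow>
    ext_lim A r E p J f = ext_lim A r E p K g"
  using assms directed[of J K] unfolding direct_limit_rel_def
  by simp (metis ext_lim_eq_iff)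

end

theorem theorem2:
  fixes A :: "'i set" and r :: "('i \<times> 'i) set"
    and E :: "'i \<Rightarrow> 'a set" and p :: "'i \<Rightarrow> 'i \<Rightarrow> 'a \<Rightarrow> 'a"
    and L :: "'i \<Rightarrow> ('a \<Rightarrow> complex) \<Rightarrow> complex"
    and E0 :: "'i \<Rightarrow> ('a \<Rightarrow> complex) set"
    and Lmin :: "(('i \<Rightarrow> 'a) \<Rightarrow> complex) \<Rightarrow> complex"
    and Dmin :: "(('i \<Rightarrow> 'a) \<Rightarrow> complex) set"
  assumes "perfect_inverse_system A r E p"
    and "projective_functionals A r E p L E0"
    and "(Lmin, Dmin) = minimal_extension A r E p L E0"
  shows "\<exists>\<Phi>. (\<forall>J\<in>A. \<forall>f\<in>E0 J. \<Phi> (limit_class A r E0 (ext_map E p) J f) = ext_lim A r E p J f) \<and>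
             bij_betw \<Phi> (direct_limit A r E0 (ext_map E p)) Dmin"
proof -
  interpret perfect_inverse_system A r E p by fact
  interpret projective_functionals A r E p L E0 by fact
  interpret direct_system A r E0 "ext_map E p" by (rule direct_system_ext_map)
  let ?e = "\<lambda>(J, f). ext_lim A r E p J f"
  have "(x, y) \<in> direct_limit_rel A r E0 (ext_map E p) \<longleftrightarrow> ?e x = ?e y"
    if "x \<in> Sigma A E0" "y \<in> Sigma A E0" for x y
    using that by (auto simp: direct_limit_rel_iff)
  from bij_betw_quotient_kernel[OF equiv_direct_limit_rel this] obtain \<Phi> where
    \<Phi>: "\<And>x. x \<in> Sigma A E0 \<Longrightarrow> \<Phi> (direct_limit_rel A r E0 (ext_map E p) `` {x}) = ?e x"
    and bij: "bij_betw \<Phi> (direct_limit A r E0 (ext_map E p)) (?e ` Sigma A E0)"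
    unfolding direct_limit_def by blast
  \<comment> \<open>The image of the disjoint union is the union over \<open>J\<close> of the images
    of \<open>E0 J\<close>, which is how the minimal domain is defined.\<close>
  have "?e ` Sigma A E0 = Dmin"
    using assms(3) by (force simp: minimal_extension_def)
  then show ?thesis
    using \<Phi> bij by (auto simp: limit_class_def)
qed

end
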